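(* Let $X$ be a non-empty set. There is a sub-operad $\mathcal{L}$ of the endomorphism operad $\mathcal{E}$ of $X$ such that $\mathcal{L}(d)=\mathcal{L}(X^d,X)$ for all positive integers $d$.
   Context: $\mathbb{N}$ denotes the positive integers. For a positive integer $d$ and $1\le s\le d+1$, let $\tau^{d+1}_s : X^{d+1}\to X^d$ be the map discarding the coordinate $s$: $\tau^{d+1}_s(x_1,\dots,x_{d+1})=(x_1,\dots,x_{s-1},x_{s+1},\dots,x_{d+1})$. A subset $L\subseteq X^{d+1}$ is a Latin hypercube of dimension $d$ over $X$ if for every $s$ with $1\le s\le d+1$ the restriction of $\tau^{d+1}_s$ to $L$ is a bijection $L\to X^d$; that is, for any choice of $d$ of the $d+1$ coordinates there is a unique element in the remaining coordinate such that the resulting element of $X^{d+1}$ belongs to $L$. $\mathcal{L}(X^d,X)$ is the subset of the set $\mathrm{Map}(X^d,X)$ of all maps $X^d\to X$ consisting of those $f$ whose graph $\{(x_1,\dots,x_d,f(x_1,\dots,x_d)) \mid x_1,\dots,x_d\in X\}\subseteq X^{d+1}$ is a Latin hypercube of dimension $d$ over $X$. The endomorphism operad $\mathcal{E}$ of $X$ consists of the sets $\mathcal{E}(n)=\mathrm{Map}(X^n,X)$ for $n$ a positive integer, with the action of the symmetric group $\mathfrak{S}_n$ on $\mathcal{E}(n)$ by permuting the $n$ coordinates of $X^n$, the unit element $\mathrm{Id}_X\in\mathcal{E}(1)$, and the structural maps $-\circ_i- : \mathrm{Map}(X^n,X)\times\mathrm{Map}(X^m,X)\to\mathrm{Map}(X^{n+m-1},X)$,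 for $1\le i\le n$, given by $$(f\circ_i g)(x_1,\dots,x_{n+m-1})=f(x_1,\dots,x_{i-1},g(x_i,\dots,x_{i+m-1}),x_{i+m},\dots,x_{n+m-1}).$$ A sub-operad of $\mathcal{E}$ is a family of subsets $\mathcal{L}(n)\subseteq\mathcal{E}(n)$, $n\ge 1$, containing the unit element, stable under the symmetric group actions, and closed under all the maps $-\circ_i-$. *)

theory Defs
  imports "HOL-Library.FuncSet" "HOL-Library.NList" "HOL-Combinatorics.Permutations"
begin

text \<open>
  The power \<open>X\<^sup>n\<close> is \<open>nlists n X\<close>, the set of lists of length \<open>n\<close> with entries in \<open>X\<close>, and
  \<open>Map(X\<^sup>n, X)\<close> is the extensional function space \<open>nlists n X \<rightarrow>\<^sub>E X\<close>, whose elements are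
  \<open>undefined\<close> outside \<open>X\<^sup>n\<close>; equality of elements is then equality of maps on \<open>X\<^sup>n\<close>.
  Coordinates are numbered from 1, except that a permutation in \<open>\<SS>\<^sub>n\<close> permutes \<open>{..<n}\<close>,
  as \<open>permute_list\<close> requires.
\<close>

definition discard :: "nat \<Rightarrow> 'a list \<Rightarrow> 'a list" where
  "discard s xs = take (s - 1) xs @ drop s xs"

definition latin_hypercube :: "'a set \<Rightarrow> nat \<Rightarrow> 'a list set \<Rightarrow> bool" where
  "latin_hypercube X d L \<longleftrightarrow>
     L \<subseteq> nlists (d + 1) X \<and> (\<forall>s\<in>{1..d + 1}. bij_betw (discard s) L (nlists d X))"

definition map_graph :: "'a set \<Rightarrow> nat \<Rightarrow> ('a list \<Rightarrow> 'a) \<Rightarrow> 'a list set" where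
  "map_graph X d f = {xs @ [f xs] | xs. xs \<in> nlists d X}"

definition endo :: "'a set \<Rightarrow> nat \<Rightarrow> ('a list \<Rightarrow> 'a) set" where
  "endo X n = nlists n X \<rightarrow>\<^sub>E X"

definition latin_maps :: "'a set \<Rightarrow> nat \<Rightarrow> ('a list \<Rightarrow> 'a) set" where
  "latin_maps X d = {f \<in> endo X d. latin_hypercube X d (map_graph X d f)}"

definition endo_unit :: "'a set \<Rightarrow> 'a list \<Rightarrow> 'a" where
  "endo_unit X = (\<lambda>xs\<in>nlists 1 X. hd xs)"

text \<open>
  The left action \<open>(\<sigma> \<cdot> f)(x\<^sub>1, \<dots>, x\<^sub>n) = f(x\<^bsub>\<sigma>(1)\<^esub>, \<dots>, x\<^bsub>\<sigma>(n)\<^esub>)\<close>. With the inverse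
  permutation on the right-hand side one gets the same stable subsets.
\<close>

definition endo_act :: "'a set \<Rightarrow> nat \<Rightarrow> (nat \<Rightarrow> nat) \<Rightarrow> ('a list \<Rightarrow> 'a) \<Rightarrow> 'a list \<Rightarrow> 'a" where
  "endo_act X n \<sigma> f = (\<lambda>xs\<in>nlists n X. f (permute_list \<sigma> xs))"

definition endo_comp ::
    "'a set \<Rightarrow> nat \<Rightarrow> nat \<Rightarrow> nat \<Rightarrow> ('a list \<Rightarrow> 'a) \<Rightarrow> ('a list \<Rightarrow> 'a) \<Rightarrow> 'a list \<Rightarrow> 'a" where
  "endo_comp X n m i f g =
     (\<lambda>xs\<in>nlists (n + m - 1) X.
        f (take (i - 1) xs @ [g (take m (drop (i - 1) xs))] @ drop (i - 1 + m) xs))"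

text \<open>Operads have no component of arity 0 here, so the value \<open>L 0\<close> of a family is irrelevant.\<close>

definition endo_suboperad :: "'a set \<Rightarrow> (nat \<Rightarrow> ('a list \<Rightarrow> 'a) set) \<Rightarrow> bool" where
  "endo_suboperad X L \<longleftrightarrow>
     (\<forall>n\<ge>1. L n \<subseteq> endo X n) \<and>
     endo_unit X \<in> L 1 \<and>
     (\<forall>n\<ge>1. \<forall>\<sigma>. \<sigma> permutes {..<n} \<longrightarrow> (\<forall>f\<in>L n. endo_act X n \<sigma> f \<in> L n)) \<and>
     (\<forall>n\<ge>1. \<forall>m\<ge>1. \<forall>i\<in>{1..n}. \<forall>f\<in>L n. \<forall>g\<in>L m. endo_comp X n m i f g \<in> L (n + m - 1))"

end

theory Submission
  imports Defs
begin

text \<open>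
  The graph of \<open>f : X\<^sup>d \<rightarrow> X\<close> is a Latin hypercube iff \<open>f\<close> restricts to a bijection \<open>X \<rightarrow> X\<close> on every
  line parallel to a coordinate axis, that is, whenever all arguments but one are held fixed
  (lemma \<open>latin_maps_iff\<close>). Discarding the last coordinate of a graph is always a bijection;
  discarding an earlier coordinate of \<open>(x\<^sub>1, \<dots>, x\<^sub>d, f x)\<close> leaves a line in that direction together
  with a value of \<open>f\<close>, and bijectivity says that each value is taken exactly once on each line.

  In this form the operad axioms are visible. The unit is the identity on the only line of
  \<open>X\<^sup>1\<close>. A permutation of the coordinates maps lines to lines. Along a line, \<open>f \<circ>\<^sub>i g\<close> is
  either \<open>f\<close> along a line, when the moving argument is not passed to \<open>g\<close>, or a line restriction of
  \<open>g\<close> followed by a line restriction of \<open>f\<close>, and bijections compose. So the sets of Latin maps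
  themselves form the sub-operad.
\<close>

section \<open>Lines and discarded coordinates\<close>

text \<open>
  As rewrite rules these two reduce a goal \<open>length xs = n\<close> to \<open>xs \<in> nlists n A\<close> for an unknown \<open>A\<close>,
  which loops in the proofs below, where \<open>nlists\<close> is unfolded.
\<close>

declare nlistsE_length [simp del] nlistsE_set [simp del]

definition bij_on_lines :: "'a set \<Rightarrow> nat \<Rightarrow> ('a list \<Rightarrow> 'a) \<Rightarrow> bool" where
  "bij_on_lines X d f \<longleftrightarrow> (\<forall>xs\<in>nlists d X. \<forall>j<d. bij_betw (\<lambda>x. f (xs[j := x])) X X)"

lemma bij_on_linesD:
  assumes "bij_on_lines X d f" "xs \<in> nlists d X" "j < d"
  shows "bij_betw (\<lambda>x. f (xs[j := x])) X X"
  using assms by (simp add: bij_on_lines_def)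

lemma endo_apply_in: "f \<in> endo X d \<Longrightarrow> xs \<in> nlists d X \<Longrightarrow> f xs \<in> X"
  unfolding endo_def by (rule PiE_mem)

lemma discard_append_last:
  assumes "j < length xs"
  shows "discard (Suc j) (xs @ [y]) = discard (Suc j) xs @ [y]"
  using assms by (simp add: discard_def)

lemma discard_list_update: "discard (Suc j) (xs[j := x]) = discard (Suc j) xs"
  by (simp add: discard_def)

text \<open>The fibres of the map discarding one coordinate are the lines in that direction.\<close>

lemma discard_eq_imp_same_line:
  assumes len: "length xs = length ys" and j: "j < length xs"
    and eq: "discard (Suc j) xs = discard (Suc j) ys"
  shows "xs = ys[j := xs ! j]"
proof -
  have "length (take j xs) = length (take j ys)" using len by simp
  moreover have "take j xs @ drop (Suc j) xs = take j ys @ drop (Suc j) ys"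
    using eq unfolding discard_def diff_Suc_1 .
  ultimately have eqs: "take j xs = take j ys" "drop (Suc j) xs = drop (Suc j) ys"
    using append_eq_append_conv by blast+
  have "xs = take j xs @ xs ! j # drop (Suc j) xs"
    using j by (rule id_take_nth_drop)
  also have "\<dots> = take j ys @ xs ! j # drop (Suc j) ys"
    by (simp only: eqs)
  also have "\<dots> = ys[j := xs ! j]"
    by (rule upd_conv_take_nth_drop[symmetric]) (use j len in simp)
  finally show ?thesis .
qed

lemma discard_in_nlists:
  assumes "xs \<in> nlists (Suc d) X" "j < Suc d"
  shows "discard (Suc j) xs \<in> nlists d X"
  using assms set_take_subset[of j xs] set_drop_subset[of "Suc j" xs]
  by (simp add: nlists_def discard_def) blast

lemma discard_insert:
  assumes "j \<le> length ws"
  shows "discard (Suc j) (take j ws @ x # drop j ws) = ws"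
  using assms by (simp add: discard_def)

section \<open>Latin maps as maps bijective on lines\<close>

lemma map_graph_subset:
  assumes "f \<in> endo X d"
  shows "map_graph X d f \<subseteq> nlists (d + 1) X"
proof
  fix u assume "u \<in> map_graph X d f"
  then obtain xs where "u = xs @ [f xs]" "xs \<in> nlists d X" by (auto simp: map_graph_def)
  then show "u \<in> nlists (d + 1) X" using endo_apply_in[OF assms] by (simp add: nlists_def)
qed

lemma bij_discard_last_map_graph: "bij_betw (discard (Suc d)) (map_graph X d f) (nlists d X)"
proof (rule bij_betw_byWitness[where f' = "\<lambda>xs. xs @ [f xs]"])
qed (auto simp: map_graph_def discard_def nlists_def)

text \<open>
  The map discarding coordinate \<open>j + 1\<close> sends the part of the graph above a line in that direction to
  pairs consisting of this line and a value of \<open>f\<close> on it. Different lines have disjoint images, so the map is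
  bijective iff on each line the values of \<open>f\<close> exhaust \<open>X\<close> without repetition.
\<close>

lemma bij_discard_map_graph_iff:
  assumes f: "f \<in> endo X d" and j: "j < d"
  shows "bij_betw (discard (Suc j)) (map_graph X d f) (nlists d X) \<longleftrightarrow>
         (\<forall>xs\<in>nlists d X. bij_betw (\<lambda>x. f (xs[j := x])) X X)"
    (is "?L \<longleftrightarrow> ?R")
proof -
  have fX: "f xs \<in> X" if "xs \<in> nlists d X" for xs
    using endo_apply_in[OF f that] .
  have disc: "discard (Suc j) (xs @ [y]) = discard (Suc j) xs @ [y]"
    if "xs \<in> nlists d X" for xs y
    using that j by (simp add: discard_append_last nlists_def)
  show ?thesis
  proof
    assume L: ?L
    show ?R
    proof
      fix xs assume xs: "xs \<in> nlists d X"
      then have len: "length xs = d" by (simp add: nlists_def)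
      note upd = nlists_update_in_list[OF xs]
      show "bij_betw (\<lambda>x. f (xs[j := x])) X X"
      proof (rule bij_betw_imageI)
        show "inj_on (\<lambda>x. f (xs[j := x])) X"
        proof (rule inj_onI)
          fix x y assume x: "x \<in> X" and y: "y \<in> X" and e: "f (xs[j := x]) = f (xs[j := y])"
          have "discard (Suc j) (xs[j := x] @ [f (xs[j := x])]) =
                discard (Suc j) (xs[j := y] @ [f (xs[j := y])])"
            using upd[OF x] upd[OF y] e by (simp add: disc discard_list_update)
          moreover have "xs[j := x] @ [f (xs[j := x])] \<in> map_graph X d f"
            "xs[j := y] @ [f (xs[j := y])] \<in> map_graph X d f"
            using upd[OF x] upd[OF y] by (auto simp: map_graph_def)
          ultimately have "xs[j := x] = xs[j := y]"
            using L by (auto simp: bij_betw_def dest: inj_onD)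
          then show "x = y" using j len by (metis nth_list_update_eq)
        qed
        show "(\<lambda>x. f (xs[j := x])) ` X = X"
        proof (intro equalityI subsetI)
          fix y assume "y \<in> (\<lambda>x. f (xs[j := x])) ` X"
          then show "y \<in> X" using fX upd by auto
        next
          fix y assume y: "y \<in> X"
          have "xs @ [y] \<in> nlists (Suc d) X" using xs y by (auto simp: nlists_def)
          then have "discard (Suc j) (xs @ [y]) \<in> nlists d X"
            by (rule discard_in_nlists) (use j in simp)
          then have "discard (Suc j) (xs @ [y]) \<in> discard (Suc j) ` map_graph X d f"
            using L by (simp add: bij_betw_def)
          then obtain zs where zs: "zs \<in> nlists d X"
            and "discard (Suc j) (xs @ [y]) = discard (Suc j) (zs @ [f zs])"
            by (auto simp: map_graph_def)
          then have e: "discard (Suc j) zs = discard (Suc j) xs" and y_eq: "y = f zs"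
            using disc xs by auto
          have lz: "length zs = d" using zs by (simp add: nlists_def)
          have "zs = xs[j := zs ! j]"
            using discard_eq_imp_same_line[OF _ _ e] lz len j by simp
          moreover have "zs ! j \<in> X" using zs lz j by (auto simp: nlists_def)
          ultimately show "y \<in> (\<lambda>x. f (xs[j := x])) ` X"
            using y_eq by (metis image_eqI)
        qed
      qed
    qed
  next
    assume R: ?R
    show ?L
    proof (rule bij_betw_imageI)
      show "inj_on (discard (Suc j)) (map_graph X d f)"
      proof (rule inj_onI)
        fix u v assume "u \<in> map_graph X d f" "v \<in> map_graph X d f"
          and e: "discard (Suc j) u = discard (Suc j) v"
        then obtain xs ys where xs: "xs \<in> nlists d X" "u = xs @ [f xs]"
          and ys: "ys \<in> nlists d X" "v = ys @ [f ys]"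
          by (auto simp: map_graph_def)
        have len: "length xs = d" "length ys = d" using xs ys by (simp_all add: nlists_def)
        have e': "discard (Suc j) xs = discard (Suc j) ys" and fe: "f xs = f ys"
          using e xs ys disc by auto
        have line: "xs = ys[j := xs ! j]"
          using discard_eq_imp_same_line[OF _ _ e'] len j by simp
        have "xs ! j \<in> X" "ys ! j \<in> X" using xs ys len j by (auto simp: nlists_def)
        moreover have "inj_on (\<lambda>x. f (ys[j := x])) X" using R ys by (auto simp: bij_betw_def)
        moreover have "f (ys[j := xs ! j]) = f (ys[j := ys ! j])" using line fe by simp
        ultimately have "xs ! j = ys ! j" unfolding inj_on_def by blast
        then show "u = v" using line xs ys by simp
      qed
      show "discard (Suc j) ` map_graph X d f = nlists d X"
      proof (intro equalityI subsetI)
        fix u assume "u \<in> discard (Suc j) ` map_graph X d f"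
        then show "u \<in> nlists d X"
          using map_graph_subset[OF f] discard_in_nlists[of _ d X j] j by auto
      next
        fix u assume u: "u \<in> nlists d X"
        then have "u \<noteq> []" using j by (auto simp: nlists_def)
        then obtain ws y where uw: "u = ws @ [y]" by (metis rev_exhaust)
        have ws: "length ws = d - 1" "set ws \<subseteq> X" and y: "y \<in> X"
          using u uw by (auto simp: nlists_def)
        \<comment> \<open>The coordinate inserted here is overwritten below; \<open>y\<close> is an arbitrary choice.\<close>
        define xs where "xs = take j ws @ y # drop j ws"
        have xs: "xs \<in> nlists d X"
          using ws y j by (auto simp: xs_def nlists_def dest: in_set_takeD in_set_dropD)
        have "y \<in> (\<lambda>x. f (xs[j := x])) ` X" using R xs y by (auto simp: bij_betw_def)
        then obtain x where x: "x \<in> X" "y = f (xs[j := x])" by auto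
        have xs': "xs[j := x] \<in> nlists d X" by (rule nlists_update_in_list[OF xs x(1)])
        have "discard (Suc j) xs = ws" using ws j by (simp add: xs_def discard_insert)
        then have "discard (Suc j) (xs[j := x] @ [f (xs[j := x])]) = u"
          using uw x xs' by (simp add: disc discard_list_update)
        moreover have "xs[j := x] @ [f (xs[j := x])] \<in> map_graph X d f"
          using xs' by (auto simp: map_graph_def)
        ultimately show "u \<in> discard (Suc j) ` map_graph X d f" by (metis image_eqI)
      qed
    qed
  qed
qed

lemma latin_maps_iff: "f \<in> latin_maps X d \<longleftrightarrow> f \<in> endo X d \<and> bij_on_lines X d f"
proof (cases "f \<in> endo X d")
  case True
  have "{1..d + 1} = insert (Suc d) (Suc ` {..<d})"
    by (simp add: image_Suc_lessThan atLeastAtMostSuc_conv)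
  then have "latin_hypercube X d (map_graph X d f) \<longleftrightarrow>
      (\<forall>j<d. bij_betw (discard (Suc j)) (map_graph X d f) (nlists d X))"
    using map_graph_subset[OF True] bij_discard_last_map_graph[of d X f]
    by (auto simp: latin_hypercube_def)
  then show ?thesis
    using True bij_discard_map_graph_iff[OF True] by (auto simp: latin_maps_def bij_on_lines_def)
qed (simp add: latin_maps_def)

section \<open>Closure under the operad structure\<close>

lemma endo_unit_in_latin_maps: "endo_unit X \<in> latin_maps X 1"
proof -
  have "bij_betw (\<lambda>x. endo_unit X (xs[0 := x])) X X" if xs: "xs \<in> nlists 1 X" for xs
  proof -
    have "endo_unit X (xs[0 := x]) = x" if "x \<in> X" for x
      using nlists_update_in_list[OF xs that] xs
      by (auto simp: endo_unit_def nlists_def length_Suc_conv)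
    then show ?thesis by (simp add: bij_betw_def inj_on_def)
  qed
  moreover have "endo_unit X \<in> endo X 1"
    by (auto simp: endo_unit_def endo_def nlists_def length_Suc_conv)
  ultimately show ?thesis by (simp add: latin_maps_iff bij_on_lines_def)
qed

lemma permute_list_update:
  assumes p: "p permutes {..<length xs}" and k: "k < length xs"
  shows "permute_list p (xs[p k := x]) = (permute_list p xs)[k := x]"
proof (rule nth_equalityI)
  fix i assume "i < length (permute_list p (xs[p k := x]))"
  then have i: "i < length xs" by simp
  have "p i < length xs" "p k < length xs" using permutes_in_image[OF p] i k by blast+
  moreover have "p i = p k \<longleftrightarrow> i = k" using permutes_inj[OF p] by (auto dest: injD)
  moreover have "permute_list p (xs[p k := x]) ! i = xs[p k := x] ! p i"
    by (rule permute_list_nth) (use p i in simp_all)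
  moreover have "permute_list p xs ! i = xs ! p i"
    by (rule permute_list_nth[OF p i])
  ultimately show "permute_list p (xs[p k := x]) ! i = (permute_list p xs)[k := x] ! i"
    using i k by (cases "i = k") simp_all
qed simp

lemma endo_act_in_latin_maps:
  assumes p: "p permutes {..<n}" and f: "f \<in> latin_maps X n"
  shows "endo_act X n p f \<in> latin_maps X n"
proof -
  have fE: "f \<in> endo X n" and fb: "bij_on_lines X n f" using f by (simp_all add: latin_maps_iff)
  have perm: "permute_list p xs \<in> nlists n X" if "xs \<in> nlists n X" for xs
    using that p by (auto simp: nlists_def)
  have "bij_betw (\<lambda>x. endo_act X n p f (xs[j := x])) X X"
    if xs: "xs \<in> nlists n X" and j: "j < n" for xs j
  proof -
    have len: "length xs = n" using xs by (simp add: nlists_def)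
    obtain k where k: "k < n" "p k = j"
      using permutes_image[OF p] j by (metis imageE lessThan_iff)
    have "endo_act X n p f (xs[j := x]) = f ((permute_list p xs)[k := x])" if "x \<in> X" for x
      using nlists_update_in_list[OF xs that] permute_list_update[of p xs k x] p k len
      by (simp add: endo_act_def)
    moreover have "bij_betw (\<lambda>x. f ((permute_list p xs)[k := x])) X X"
      by (rule bij_on_linesD[OF fb perm[OF xs] k(1)])
    ultimately show ?thesis by (simp cong: bij_betw_cong)
  qed
  moreover have "endo_act X n p f \<in> endo X n"
    unfolding endo_act_def endo_def using endo_apply_in[OF fE perm] by simp
  ultimately show ?thesis by (simp add: latin_maps_iff bij_on_lines_def)
qed

text \<open>
  The argument of \<open>f\<close> in a partial composition is here split as \<open>us @ g vs # ws\<close>. A moving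
  coordinate lies in one of the three blocks, and only when it lies in \<open>vs\<close> does the value of \<open>g\<close> vary.
\<close>

lemma bij_on_lines_comp:
  assumes f: "bij_on_lines X n f" and g: "bij_on_lines X m g" and gX: "g \<in> endo X m"
    and us: "us \<in> nlists k X" and vs: "vs \<in> nlists m X" and ws: "ws \<in> nlists l X"
    and n: "n = k + 1 + l" and j: "j < k + m + l"
    and F: "\<And>us vs ws. us \<in> nlists k X \<Longrightarrow> vs \<in> nlists m X \<Longrightarrow> ws \<in> nlists l X \<Longrightarrow>
              F (us @ vs @ ws) = f (us @ g vs # ws)"
  shows "bij_betw (\<lambda>x. F ((us @ vs @ ws)[j := x])) X X"
proof -
  have len: "length us = k" "length vs = m" "length ws = l"
    using us vs ws by (simp_all add: nlists_def)
  have gvs: "g vs \<in> X" using endo_apply_in[OF gX vs] .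
  have base: "us @ g vs # ws \<in> nlists n X"
    using us ws gvs n by (auto simp: nlists_def)
  note line = bij_on_linesD[OF f base]
  consider "j < k" | "k \<le> j" "j < k + m" | "k + m \<le> j" by linarith
  then show ?thesis
  proof cases
    case 1
    have "F ((us @ vs @ ws)[j := x]) = f ((us @ g vs # ws)[j := x])" if "x \<in> X" for x
      using 1 len F[OF nlists_update_in_list[OF us that] vs ws]
      by (simp add: list_update_append1)
    then show ?thesis using line[of j] 1 n by (simp cong: bij_betw_cong)
  next
    case 2
    then have jk: "j - k < m" by arith
    have "F ((us @ vs @ ws)[j := x]) = f ((us @ g vs # ws)[k := g (vs[j - k := x])])"
      if "x \<in> X" for x
      using 2 jk len F[OF us nlists_update_in_list[OF vs that] ws]
      by (simp add: list_update_append)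
    moreover have "bij_betw (\<lambda>x. g (vs[j - k := x])) X X"
      using bij_on_linesD[OF g vs, of "j - k"] 2 by simp
    then have "bij_betw ((\<lambda>y. f ((us @ g vs # ws)[k := y])) \<circ> (\<lambda>x. g (vs[j - k := x]))) X X"
      by (rule bij_betw_trans) (use line[of k] n in simp)
    ultimately show ?thesis by (simp add: o_def cong: bij_betw_cong)
  next
    case 3
    then obtain i where i: "j = k + m + i" using le_Suc_ex by blast
    have "F ((us @ vs @ ws)[j := x]) = f ((us @ g vs # ws)[Suc (k + i) := x])"
      if "x \<in> X" for x
    proof -
      have "Suc (k + i) - k = Suc i" by simp
      then show ?thesis
        using i len F[OF us vs nlists_update_in_list[OF ws that]]
        by (simp add: list_update_append)
    qed
    then show ?thesis using line[of "Suc (k + i)"] i n j by (simp cong: bij_betw_cong)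
  qed
qed

lemma nlists_split3:
  assumes "xs \<in> nlists (k + m + l) X"
  obtains us vs ws where "xs = us @ vs @ ws"
    "us \<in> nlists k X" "vs \<in> nlists m X" "ws \<in> nlists l X"
proof
  show "xs = take k xs @ take m (drop k xs) @ drop m (drop k xs)"
    by (simp only: append_take_drop_id)
qed (use assms in \<open>auto simp: nlists_def dest!: in_set_takeD in_set_dropD\<close>)

lemma endo_comp_in_latin_maps:
  assumes i: "i \<in> {1..n}" and f: "f \<in> latin_maps X n" and g: "g \<in> latin_maps X m"
  shows "endo_comp X n m i f g \<in> latin_maps X (n + m - 1)"
proof -
  have fE: "f \<in> endo X n" and fb: "bij_on_lines X n f" using f by (simp_all add: latin_maps_iff)
  have gE: "g \<in> endo X m" and gb: "bij_on_lines X m g" using g by (simp_all add: latin_maps_iff)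
  define k l where "k = i - 1" and "l = n - i"
  have n: "n = k + 1 + l" using i by (simp add: k_def l_def)
  then have arity: "n + m - 1 = k + m + l" by simp
  have comp: "endo_comp X n m i f g (us @ vs @ ws) = f (us @ g vs # ws)"
    if "us \<in> nlists k X" "vs \<in> nlists m X" "ws \<in> nlists l X" for us vs ws
  proof -
    have "us @ vs @ ws \<in> nlists (n + m - 1) X"
      unfolding arity using that by (simp add: nlists_def)
    moreover have "length us = k" "length vs = m" using that by (simp_all add: nlists_def)
    ultimately show ?thesis unfolding endo_comp_def k_def[symmetric] by simp
  qed
  have "endo_comp X n m i f g xs \<in> X" if xs: "xs \<in> nlists (k + m + l) X" for xs
    using xs
  proof (rule nlists_split3)
    fix us vs ws assume s: "xs = us @ vs @ ws"
      "us \<in> nlists k X" "vs \<in> nlists m X" "ws \<in> nlists l X"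
    then have "g vs \<in> X" using endo_apply_in[OF gE] by simp
    then have "us @ g vs # ws \<in> nlists n X" using s n by (auto simp: nlists_def)
    then show ?thesis using s comp endo_apply_in[OF fE] by simp
  qed
  moreover have "endo_comp X n m i f g xs = undefined" if "xs \<notin> nlists (k + m + l) X" for xs
    using that unfolding endo_comp_def arity by simp
  ultimately have "endo_comp X n m i f g \<in> endo X (n + m - 1)"
    unfolding endo_def arity by (rule PiE_I)
  moreover have "bij_on_lines X (k + m + l) (endo_comp X n m i f g)"
    unfolding bij_on_lines_def
  proof (intro ballI allI impI)
    fix xs j assume "xs \<in> nlists (k + m + l) X" and j: "j < k + m + l"
    then show "bij_betw (\<lambda>x. endo_comp X n m i f g (xs[j := x])) X X"
      by (elim nlists_split3)
        (use bij_on_lines_comp[OF fb gb gE _ _ _ n j, where F = "endo_comp X n m i f g"] comp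
          in blast)
  qed
  ultimately show ?thesis unfolding latin_maps_iff arity by simp
qed

theorem theorem1p2:
  fixes X :: "'a set"
  assumes "X \<noteq> {}"
  shows "\<exists>L. endo_suboperad X L \<and> (\<forall>d\<ge>1. L d = latin_maps X d)"
proof (intro exI conjI allI impI)
  have "latin_maps X n \<subseteq> endo X n" for n by (auto simp: latin_maps_def)
  then show "endo_suboperad X (latin_maps X)"
    unfolding endo_suboperad_def
    using endo_unit_in_latin_maps endo_act_in_latin_maps endo_comp_in_latin_maps by blast
qed (rule refl)

end
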